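(* Let $p\ge 1$ be an integer, $n=2p+1$, and let $k>0$ be a real number. Let $C_n^{\varphi}$ be a conjugate skew gain graph on the cycle $C_n$ such that $|\varphi(\overrightarrow{e})|=k$ for every oriented edge $\overrightarrow{e}$, and suppose that $C_n^{\varphi}$ is unbalanced. Let $\theta=\arg(\varphi(C_n^{\varphi}))$ be an argument of the gain of the cycle (with respect to a fixed orientation of the cycle). Then the distance spectrum of $C_n^{\varphi}$, i.e. the list of eigenvalues of the distance matrix $D(C_n^{\varphi})$, is given by $$\lambda_j=\frac{2f(\theta_j)}{g(\theta_j)},\qquad \theta_j=\frac{2\pi j+\theta}{n},\qquad j=0,1,\ldots,n-1,$$ where $$f(t)=pk^{p+2}\cos((p+2)t)-k^{p+1}\big(p(2k^2+1)+1\big)\cos((p+1)t)+k^{p+2}\big(p(k^2+2)+2\big)\cos(pt)-(p+1)k^{p+3}\cos((p-1)t)+k(k^2+1)\cos t-2k^2$$ and $$g(t)=(1-2k\cos t+k^2)^2.$$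
   Context: Conjugate skew gain graph (csg): for a graph $G=(V,E)$, $\overrightarrow{E}$ is the set of oriented edges, where each edge $uv\in E$ gives two oriented edges $\overrightarrow{uv}$ and $\overrightarrow{vu}$. A csg $G^{\varphi}$ is $G$ together with a function $\varphi:\overrightarrow{E}\to\mathbb{C}^{\times}=\mathbb{C}\setminus\{0\}$ satisfying $\varphi(\overrightarrow{vu})=\overline{\varphi(\overrightarrow{uv})}$. The gain of an oriented path or oriented cycle is the product of the gains of its successive oriented edges. $G^{\varphi}$ is balanced if $\varphi(\overrightarrow{C})=|\varphi(\overrightarrow{C})|$ for every oriented cycle $\overrightarrow{C}$, and unbalanced otherwise. Distance matrix: if for all distinct vertices $u,v$ all shortest oriented paths from $u$ to $v$ have the same gain, denoted $\varphi_{(u,v)}$ (this holds for odd cycles, where shortest paths are unique), the distance matrix $D(G^{\varphi})$ is the $n\times n$ matrix indexed by the vertices with $(u,v)$ entry $\varphi_{(u,v)}\,d(u,v)$ for $u\ne v$, where $d$ is the graph distance, and zero diagonal. *)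

theory Defs
  imports
    "HOL-Analysis.Analysis"
    "Graph_Theory.Graph_Theory"
    "Jordan_Normal_Form.Char_Poly"
begin

(* A finite simple graph is a pair_graph: a finite, loop-free, symmetric digraph whose arcs are
   ordered pairs of vertices.  The arcs (u, v) and (v, u) are the two orientations of the edge uv.
   Values of the gain function outside the arc set are irrelevant. *)
locale conj_skew_gain_graph = pair_graph G
  for G :: "'a pair_pre_digraph" +
  fixes \<phi> :: "'a \<times> 'a \<Rightarrow> complex"
  assumes gain_nonzero: "e \<in> parcs G \<Longrightarrow> \<phi> e \<noteq> 0"
    and gain_conj: "(u, v) \<in> parcs G \<Longrightarrow> \<phi> (v, u) = cnj (\<phi> (u, v))"

definition gain :: "('a \<times> 'a \<Rightarrow> complex) \<Rightarrow> ('a \<times> 'a) list \<Rightarrow> complex" where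
  "gain \<phi> es = prod_list (map \<phi> es)"

(* pre_digraph.cycle also accepts the closed walk (u, v), (v, u) along a single edge, which is not a
   cycle of the undirected graph; the length bound excludes it. *)
definition oriented_cycle :: "'a pair_pre_digraph \<Rightarrow> ('a \<times> 'a) list \<Rightarrow> bool" where
  "oriented_cycle G C \<longleftrightarrow> pre_digraph.cycle (with_proj G) C \<and> 3 \<le> length C"

definition balanced :: "'a pair_pre_digraph \<Rightarrow> ('a \<times> 'a \<Rightarrow> complex) \<Rightarrow> bool" where
  "balanced G \<phi> \<longleftrightarrow> (\<forall>C. oriented_cycle G C \<longrightarrow> gain \<phi> C = of_real (cmod (gain \<phi> C)))"

definition gdist :: "'a pair_pre_digraph \<Rightarrow> 'a \<Rightarrow> 'a \<Rightarrow> ereal" where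
  "gdist G u v = wf_digraph.\<mu> (with_proj G) (\<lambda>_. 1) u v"

definition shortest_path ::
  "'a pair_pre_digraph \<Rightarrow> 'a \<Rightarrow> ('a \<times> 'a) list \<Rightarrow> 'a \<Rightarrow> bool" where
  "shortest_path G u es v \<longleftrightarrow>
     pre_digraph.apath (with_proj G) u es v \<and> ereal (real (length es)) = gdist G u v"

(* The common gain of all shortest paths from u to v; unspecified if they do not all agree. *)
definition shortest_gain ::
  "'a pair_pre_digraph \<Rightarrow> ('a \<times> 'a \<Rightarrow> complex) \<Rightarrow> 'a \<Rightarrow> 'a \<Rightarrow> complex" where
  "shortest_gain G \<phi> u v = (THE z. \<exists>es. shortest_path G u es v \<and> gain \<phi> es = z)"

(* For connected graphs on the vertex set {0..<n}, which then also indexes rows and columns. *)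
definition distance_matrix ::
  "nat pair_pre_digraph \<Rightarrow> (nat \<times> nat \<Rightarrow> complex) \<Rightarrow> complex mat" where
  "distance_matrix G \<phi> = mat (card (pverts G)) (card (pverts G))
     (\<lambda>(u, v). if u = v then 0
               else shortest_gain G \<phi> u v * of_real (real_of_ereal (gdist G u v)))"

(* Eigenvalues with algebraic multiplicity. *)
definition distance_spectrum ::
  "nat pair_pre_digraph \<Rightarrow> (nat \<times> nat \<Rightarrow> complex) \<Rightarrow> complex multiset" where
  "distance_spectrum G \<phi> = proots (char_poly (distance_matrix G \<phi>))"

definition cycle_graph :: "nat \<Rightarrow> nat pair_pre_digraph" where
  "cycle_graph n = \<lparr> pverts = {0..<n},
     parcs = {(u, v). u < n \<and> v < n \<and> (v = (u + 1) mod n \<or> u = (v + 1) mod n)} \<rparr>"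

lemma pair_graph_cycle_graph:
  assumes "3 \<le> n"
  shows "pair_graph (cycle_graph n)"
proof -
  have fin: "finite (parcs (cycle_graph n))"
    by (rule finite_subset[of _ "{0..<n} \<times> {0..<n}"]) (auto simp: cycle_graph_def)
  have irr: "Suc x mod n \<noteq> x" if "x < n" for x
    using assms that by (cases "Suc x = n") auto
  show ?thesis
    using fin
    by unfold_locales
      (auto simp: cycle_graph_def symmetric_def sym_def simp: irr irr[symmetric])
qed

definition spec_num :: "nat \<Rightarrow> real \<Rightarrow> real \<Rightarrow> real" where
  "spec_num p k t =
     real p * k ^ (p + 2) * cos ((real p + 2) * t)
     - k ^ (p + 1) * (real p * (2 * k\<^sup>2 + 1) + 1) * cos ((real p + 1) * t)
     + k ^ (p + 2) * (real p * (k\<^sup>2 + 2) + 2) * cos (real p * t)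
     - (real p + 1) * k ^ (p + 3) * cos ((real p - 1) * t)
     + k * (k\<^sup>2 + 1) * cos t
     - 2 * k\<^sup>2"

definition spec_den :: "real \<Rightarrow> real \<Rightarrow> real" where
  "spec_den k t = (1 - 2 * k * cos t + k\<^sup>2)\<^sup>2"

end

theory Submission
  imports Defs "HOL-Number_Theory.Cong"
begin

text \<open>
  A walk on the cycle has a displacement, the number of its forward minus the number of its backward
  arcs, which its end points determine modulo \<open>n = 2p + 1\<close>. Hence the vertices at distance
  \<open>m\<close> from \<open>u\<close> are \<open>u + m\<close> and \<open>u - m\<close>, each with a unique
  shortest path, and an oriented cycle is a full turn. If \<open>c\<close> is an \<open>n\<close>-th root of the gain
  of the forward turn and \<open>W v\<close> is the gain of the forward path from \<open>0\<close> to \<open>v\<close>,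
  then the vector \<open>c ^ v / W v\<close> is multiplied by \<open>c\<close> along forward arcs and by
  \<open>cnj c\<close> along backward ones. It is therefore an eigenvector, with eigenvalue
  \<open>2 * (\<Sum>m=1..p. m * Re (c ^ m))\<close>. The \<open>n\<close> roots give a diagonal conjugate of a
  Fourier matrix, and the eigenvalue has the stated closed form wherever the denominator does not
  vanish, which imbalance guarantees.
\<close>

section \<open>Closed form of the weighted cosine sum\<close>

text \<open>With z = k e^(it), the sum is the real part of the sum of m z^m, and
  \<open>spec_den\<close> is |1 - z|^4. With the denominator multiplied out, the identity holds for
  all k and t and yields to induction on p: each step adds one term times
  \<open>spec_den\<close>.\<close>

lemma spec_num_eq:
  "spec_num p k t = spec_den k t * (\<Sum>m=1..p. real m * k ^ m * cos (real m * t))"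
proof (induction p)
  case 0
  show ?case by (simp add: spec_num_def power2_eq_square power3_eq_cube algebra_simps)
next
  case (Suc p)
  \<comment> \<open>Centred at x, the angles in both numerators are x, x +- t and x +- 2t. With cos
    2t written as 2c^2 - 1, s occurs only in the product S * s, and the claim becomes a polynomial
    identity.\<close>
  define x c s C S where "x = (real p + 1) * t"
    and "c = cos t" and "s = sin t" and "C = cos x" and "S = sin x"
  have c2: "cos (2 * t) = 2 * c\<^sup>2 - 1" and s2: "sin (2 * t) = 2 * s * c"
    unfolding c_def s_def by (simp_all add: cos_double_cos sin_double)
  have angles: "(real p + 3) * t = x + 2 * t" "(real p + 2) * t = x + t"
    "real p * t = x - t" "(real p - 1) * t = x - 2 * t"
    by (simp_all add: x_def algebra_simps)
  have add2: "cos (x + 2 * t) = C * (2 * c\<^sup>2 - 1) - S * (2 * s * c)"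
    and add1: "cos (x + t) = C * c - S * s"
    and sub1: "cos (x - t) = C * c + S * s"
    and sub2: "cos (x - 2 * t) = C * (2 * c\<^sup>2 - 1) + S * (2 * s * c)"
    unfolding C_def S_def by (simp_all only: cos_add cos_diff c2 s2) (simp_all add: c_def s_def)
  have "spec_num (Suc p) k t - spec_num p k t = spec_den k t * (real (Suc p) * k ^ Suc p * C)"
  proof -
    have 1: "spec_num (Suc p) k t =
      (real p + 1) * k ^ (p + 3) * (C * (2 * c\<^sup>2 - 1) - S * (2 * s * c))
     - k ^ (p + 2) * ((real p + 1) * (2 * k\<^sup>2 + 1) + 1) * (C * c - S * s)
     + k ^ (p + 3) * ((real p + 1) * (k\<^sup>2 + 2) + 2) * C
     - (real p + 2) * k ^ (p + 4) * (C * c + S * s)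
     + k * (k\<^sup>2 + 1) * c - 2 * k\<^sup>2"
    proof -
      have "spec_num (Suc p) k t =
       (real p + 1) * k ^ (p + 3) * cos ((real p + 3) * t)
     - k ^ (p + 2) * ((real p + 1) * (2 * k\<^sup>2 + 1) + 1) * cos ((real p + 2) * t)
     + k ^ (p + 3) * ((real p + 1) * (k\<^sup>2 + 2) + 2) * cos x
     - (real p + 2) * k ^ (p + 4) * cos (real p * t)
     + k * (k\<^sup>2 + 1) * cos t - 2 * k\<^sup>2"
        by (simp add: spec_num_def x_def add_ac numeral_eq_Suc)
      then show ?thesis unfolding angles add2 add1 sub1 by (simp add: C_def c_def)
    qed
    have 2: "spec_num p k t =
      real p * k ^ (p + 2) * (C * c - S * s)
     - k ^ (p + 1) * (real p * (2 * k\<^sup>2 + 1) + 1) * C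
     + k ^ (p + 2) * (real p * (k\<^sup>2 + 2) + 2) * (C * c + S * s)
     - (real p + 1) * k ^ (p + 3) * (C * (2 * c\<^sup>2 - 1) + S * (2 * s * c))
     + k * (k\<^sup>2 + 1) * c - 2 * k\<^sup>2"
      unfolding spec_num_def angles add1 sub1 sub2 by (simp add: x_def[symmetric] C_def c_def)
    show ?thesis
      unfolding 1 2 spec_den_def c_def[symmetric] power_add
      by (simp add: algebra_simps power2_eq_square power3_eq_cube power4_eq_xxxx)
  qed
  then show ?case
    using Suc.IH by (simp add: algebra_simps C_def x_def)
qed

text \<open>The base of the square is |1 - k e^(it)|^2 = (1 - k)^2 + 2k(1 - cos t), which for k > 0
  vanishes only if k = 1 and cos t = 1.\<close>

lemma spec_den_pos:
  assumes "k > 0" and "cos t \<noteq> 1"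
  shows "spec_den k t > 0"
proof -
  have "cos t < 1" using assms(2) cos_le_one[of t] by linarith
  then have "0 < 2 * k * (1 - cos t)" using assms(1) by simp
  also have "\<dots> \<le> (1 - k)\<^sup>2 + 2 * k * (1 - cos t)" by simp
  also have "\<dots> = 1 - 2 * k * cos t + k\<^sup>2"
    by (simp add: power2_eq_square algebra_simps)
  finally show ?thesis by (simp add: spec_den_def)
qed

section \<open>Spectrum from an explicit eigenbasis\<close>

text \<open>The columns of P are eigenvectors, so A is similar to a diagonal matrix. Going through
  the characteristic polynomial keeps multiplicities when values of \<open>l\<close>
  coincide.\<close>

lemma char_poly_eigenbasis:
  fixes A P Q :: "'a :: field mat"
  assumes A: "A \<in> carrier_mat n n" and P: "P \<in> carrier_mat n n" and Q: "Q \<in> carrier_mat n n"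
    and QP: "Q * P = 1\<^sub>m n" and AP: "A * P = P * mat_diag n l"
  shows "char_poly A = (\<Prod>j\<leftarrow>[0..<n]. [:- l j, 1:])"
proof -
  have PQ: "P * Q = 1\<^sub>m n" using mat_mult_left_right_inverse[OF Q P QP] .
  have "A = A * (P * Q)" using A by (simp add: PQ)
  also have "\<dots> = P * mat_diag n l * Q" using A P Q by (simp flip: assoc_mult_mat AP)
  finally have "similar_mat_wit A (mat_diag n l) P Q"
    using A P Q PQ QP by (auto simp: similar_mat_wit_def Let_def)
  then have "char_poly A = char_poly (mat_diag n l)"
    by (intro char_poly_similar) (auto simp: similar_mat_def)
  also have "\<dots> = (\<Prod>a\<leftarrow>diag_mat (mat_diag n l). [:- a, 1:])"
    by (rule char_poly_upper_triangular[of _ n]) (auto simp: mat_diag_def)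
  also have "diag_mat (mat_diag n l) = map l [0..<n]"
    by (auto simp: diag_mat_def mat_diag_def)
  finally show ?thesis by (simp add: o_def)
qed

lemma proots_prod_linear_factors:
  fixes l :: "'b \<Rightarrow> 'a :: idom"
  shows "proots (\<Prod>j\<leftarrow>js. [:- l j, 1:]) = mset (map l js)"
proof (induction js)
  case (Cons j js)
  have "(\<Prod>j\<leftarrow>js. [:- l j, 1:]) \<noteq> 0" by (auto simp: prod_list_zero_iff)
  then show ?case using Cons.IH by (simp add: proots_mult del: mult_pCons_left)
qed simp

text \<open>The quotient is a nontrivial n-th root of unity; this is the orthogonality relation that
  inverts the Fourier matrix.\<close>

lemma sum_powers_ratio_roots:
  fixes a b :: "'a :: field"
  assumes "a ^ n = b ^ n" and "b \<noteq> 0" and "a \<noteq> b"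
  shows "(\<Sum>v<n. (a / b) ^ v) = 0"
proof -
  have "a / b \<noteq> 1" and "(a / b) ^ n = 1"
    using assms by (auto simp: power_divide)
  then show ?thesis using geometric_sum[of "a / b" n] by simp
qed

section \<open>One-directional walks and cyclic sums\<close>

text \<open>A backward step on the cycle is a step of size \<open>s = n - 1\<close>.\<close>

primrec steps :: "nat \<Rightarrow> nat \<Rightarrow> nat \<Rightarrow> nat \<Rightarrow> (nat \<times> nat) list" where
  "steps n s u 0 = []"
| "steps n s u (Suc m) = (u, (u + s) mod n) # steps n s ((u + s) mod n) m"

lemma length_steps [simp]: "length (steps n s u m) = m"
  by (induction m arbitrary: u) auto

text \<open>The relation between x at the two ends of an arc telescopes along the walk. It serves
  both directions: \<open>c\<close> with step 1, \<open>cnj c\<close> with step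
  \<open>n - 1\<close>.\<close>

lemma gain_steps:
  assumes "\<And>u. u < n \<Longrightarrow> \<phi> (u, (u + s) mod n) * x ((u + s) mod n) = c * x u" and "u < n"
  shows "gain \<phi> (steps n s u m) * x ((u + m * s) mod n) = c ^ m * x u"
  using \<open>u < n\<close>
proof (induction m arbitrary: u)
  case 0
  then show ?case by (simp add: gain_def)
next
  case (Suc m)
  let ?v = "(u + s) mod n"
  have "(?v + m * s) mod n = (u + Suc m * s) mod n"
    by (simp add: mod_simps add_ac)
  moreover have "gain \<phi> (steps n s ?v m) * x ((?v + m * s) mod n) = c ^ m * x ?v"
    using Suc.prems by (intro Suc.IH) auto
  ultimately have "gain \<phi> (steps n s u (Suc m)) * x ((u + Suc m * s) mod n)
      = c ^ m * (\<phi> (u, ?v) * x ?v)"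
    by (simp add: gain_def mult_ac)
  then show ?case using assms(1)[OF Suc.prems] by (simp add: mult_ac)
qed

text \<open>Since n is odd, each vertex other than u is u + m or u - m for exactly one choice of
  sign and one m in 1..p.\<close>

lemma sum_cyclic_split:
  fixes F :: "nat \<Rightarrow> 'a :: comm_monoid_add"
  assumes "u < n" and n: "n = 2 * p + 1"
  shows "(\<Sum>v<n. F v) = F u + (\<Sum>m=1..p. F ((u + m) mod n) + F ((u + m * (n - 1)) mod n))"
proof -
  have inj: "inj_on (\<lambda>i. (u + i) mod n) {..<n}"
  proof (rule inj_onI)
    fix i j assume "i \<in> {..<n}" "j \<in> {..<n}" "(u + i) mod n = (u + j) mod n"
    then show "i = j"
      by (metis cong_def cong_add_lcancel_nat lessThan_iff mod_less)
  qed
  have "(\<lambda>i. (u + i) mod n) ` {..<n} = {..<n}"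
    using n inj by (intro endo_inj_surj) auto
  then have "(\<Sum>v<n. F v) = (\<Sum>i<n. F ((u + i) mod n))"
    using sum.reindex[OF inj, of F] by simp
  also have "\<dots> = F u + (\<Sum>i=1..2*p. F ((u + i) mod n))"
    using \<open>u < n\<close> unfolding n
    by (simp add: lessThan_Suc_atMost atMost_atLeast0 sum.atLeast_Suc_atMost)
  also have "(\<Sum>i=1..2*p. F ((u + i) mod n)) =
      (\<Sum>i=1..p. F ((u + i) mod n)) + (\<Sum>i=p+1..2*p. F ((u + i) mod n))"
    by (subst sum.union_disjoint[symmetric]) (auto intro!: sum.cong)
  also have "(\<Sum>i=p+1..2*p. F ((u + i) mod n)) = (\<Sum>m=1..p. F ((u + m * (n - 1)) mod n))"
  proof (rule sum.reindex_bij_witness[where i = "\<lambda>m. n - m" and j = "\<lambda>i. n - i"])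
    fix i assume i: "i \<in> {p+1..2*p}"
    then obtain m where m: "n = i + m" using n by (auto intro: that[of "n - i"])
    have "(u + m * (n - 1)) mod n = (u + i) mod n"
    proof -
      have "1 \<le> m" using m n i by auto
      then obtain m' where m': "m = Suc m'" by (cases m) auto
      \<comment> \<open>Here m' = m - 1 and n = i + m: going back by m is going forward by i, up to
        whole turns.\<close>
      have "u + m * (n - 1) = u + i + m' * n"
        using m m' by (simp add: algebra_simps)
      then show ?thesis by (simp only: mod_mult_self1)
    qed
    then show "F ((u + (n - i) * (n - 1)) mod n) = F ((u + i) mod n)" using m by simp
  qed (use n in auto)
  finally show ?thesis by (simp add: sum.distrib)
qed

section \<open>Walks, distances and oriented cycles in the cycle graph\<close>

locale cycle_digraph =
  fixes n :: nat
  assumes n3: "3 \<le> n"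

sublocale cycle_digraph \<subseteq> pair_graph "cycle_graph n"
  using pair_graph_cycle_graph[OF n3] .

context cycle_digraph
begin

lemma pverts_cycle_graph [simp]: "pverts (cycle_graph n) = {0..<n}"
  by (simp add: cycle_graph_def)

text \<open>Adding n - 1 undoes adding 1 modulo n, so both directions become instances of
  \<open>steps\<close>.\<close>

lemma parcs_cycle_graph_iff:
  "(u, v) \<in> parcs (cycle_graph n) \<longleftrightarrow>
     u < n \<and> (v = (u + 1) mod n \<or> v = (u + (n - 1)) mod n)"
proof -
  have *: "u = (v + 1) mod n \<longleftrightarrow> v = (u + (n - 1)) mod n" if "u < n" "v < n"
  proof
    assume "u = (v + 1) mod n"
    then have "(u + (n - 1)) mod n = (v + 1 + (n - 1)) mod n"
      by (metis mod_add_left_eq)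
    then show "v = (u + (n - 1)) mod n" using that by simp
  next
    assume "v = (u + (n - 1)) mod n"
    then have "(v + 1) mod n = (u + (n - 1) + 1) mod n"
      by (metis mod_add_left_eq)
    then show "u = (v + 1) mod n" using that by simp
  qed
  show ?thesis using * n3 by (auto simp: cycle_graph_def)
qed

lemma awalk_steps:
  assumes "s \<in> {1, n - 1}" and "u < n"
  shows "awalk u (steps n s u m) ((u + m * s) mod n)"
  using \<open>u < n\<close>
proof (induction m arbitrary: u)
  case 0
  then show ?case by (simp add: awalk_Nil_iff)
next
  case (Suc m)
  let ?v = "(u + s) mod n"
  have "(?v + m * s) mod n = (u + Suc m * s) mod n"
    by (simp add: mod_simps add_ac)
  moreover have "awalk ?v (steps n s ?v m) ((?v + m * s) mod n)"
    using Suc.prems by (intro Suc.IH) auto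
  ultimately show ?case
    using assms(1) Suc.prems by (auto simp: awalk_Cons_iff parcs_cycle_graph_iff)
qed

text \<open>\<open>a\<close> and \<open>b\<close> count the forward and the backward arcs of the walk.\<close>

lemma awalk_displacement:
  assumes "awalk u es v"
  obtains a b where "length es = a + b" and "[int v = int u + int a - int b] (mod int n)"
    and "b = 0 \<Longrightarrow> es = steps n 1 u a" and "a = 0 \<Longrightarrow> es = steps n (n - 1) u b"
  using assms
proof (induction es arbitrary: u thesis)
  case Nil
  then show ?case using Nil(1)[of 0 0] by (auto simp: awalk_Nil_iff)
next
  case (Cons e es)
  obtain w where e: "e = (u, w)" "(u, w) \<in> parcs (cycle_graph n)" and w: "awalk w es v"
    using Cons.prems(2) by (cases e) (auto simp: awalk_Cons_iff)
  obtain a b where ab: "length es = a + b" "[int v = int w + int a - int b] (mod int n)"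
    "b = 0 \<Longrightarrow> es = steps n 1 w a" "a = 0 \<Longrightarrow> es = steps n (n - 1) w b"
    using Cons.IH[OF _ w] by blast
  consider "w = (u + 1) mod n" | "w = (u + (n - 1)) mod n" "w \<noteq> (u + 1) mod n"
    using e(2) unfolding parcs_cycle_graph_iff by blast
  then show ?case
  proof cases
    case 1
    have "[int w = int u + 1] (mod int n)"
      using 1 by (simp add: cong_def zmod_int add.commute)
    then have "[int w + (int a - int b) = int u + 1 + (int a - int b)] (mod int n)"
      by (intro cong_add cong_refl)
    with ab(2) have "[int v = int u + int (Suc a) - int b] (mod int n)"
      by (auto intro: cong_trans simp: algebra_simps)
    then show ?thesis
      using Cons.prems(1)[of "Suc a" b] ab 1 e by auto
  next
    case 2
    have "[int w = int u - 1] (mod int n)"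
    proof -
      have "int w = (int u - 1 + int n) mod int n"
        using 2 n3 by (simp add: zmod_int of_nat_diff algebra_simps)
      then show ?thesis by (simp add: cong_def)
    qed
    then have "[int w + (int a - int b) = int u - 1 + (int a - int b)] (mod int n)"
      by (intro cong_add cong_refl)
    with ab(2) have "[int v = int u + int a - int (Suc b)] (mod int n)"
      by (auto intro: cong_trans simp: algebra_simps)
    then show ?thesis
      using Cons.prems(1)[of a "Suc b"] ab 2 e by auto
  qed
qed

lemma steps_displacement:
  "[int ((u + m * (n - 1)) mod n) = int u - int m] (mod int n)"
proof -
  have "int (u + m * (n - 1)) = int u + int m * (int n - 1)"
    using n3 by (simp add: of_nat_diff)
  also have "\<dots> = int u - int m + int m * int n"
    by (simp add: algebra_simps)
  finally show ?thesis unfolding cong_def zmod_int by (simp only: mod_mod_trivial mod_mult_self1)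
qed

text \<open>Measured in the direction of s, the displacement d of the walk is congruent to m modulo
  n. Hence the length is at least |d|, which is at least m, and equality leaves no arc in the
  opposite direction.\<close>

lemma awalk_geodesic:
  assumes "s \<in> {1, n - 1}" and "2 * m < n" and "awalk u es ((u + m * s) mod n)"
  shows "m \<le> length es" and "length es = m \<Longrightarrow> es = steps n s u m"
proof -
  \<comment> \<open>As 2m < n, m has strictly the smallest absolute value in its class. Strictness
    excludes d = -m, a walk of length m the other way round.\<close>
  have far: "\<bar>d\<bar> \<ge> int m \<and> (d \<noteq> int m \<longrightarrow> \<bar>d\<bar> > int m)" if d: "[d = int m] (mod int n)" for d
  proof -
    obtain q where "d - int m = int n * q"
      using d unfolding cong_iff_dvd_diff dvd_def by blast
    then have q: "d = int m + int n * q" by simp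
    consider "q = 0" | "q \<ge> 1" | "q \<le> -1" by linarith
    then show ?thesis
    proof cases
      case 2
      then have "int n * 1 \<le> int n * q" by (intro mult_left_mono) auto
      then show ?thesis using q assms(2) by linarith
    next
      case 3
      then have "int n * q \<le> int n * (-1)" by (intro mult_left_mono) auto
      then show ?thesis using q assms(2) by linarith
    qed (use q in auto)
  qed
  obtain a b where ab: "length es = a + b"
    "[int ((u + m * s) mod n) = int u + int a - int b] (mod int n)"
    "b = 0 \<Longrightarrow> es = steps n 1 u a" "a = 0 \<Longrightarrow> es = steps n (n - 1) u b"
    using awalk_displacement[OF assms(3)] by blast
  have "m \<le> length es \<and> (length es = m \<longrightarrow> es = steps n s u m)"
  proof (cases "s = 1")
    case True
    then have "[int u + int m = int u + int a - int b] (mod int n)"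
      using ab(2) by (simp add: cong_def zmod_int)
    then have "[int u + (int a - int b) = int u + int m] (mod int n)"
      by (simp add: cong_sym algebra_simps)
    then have "[int a - int b = int m] (mod int n)"
      by (simp only: cong_add_lcancel)
    from far[OF this] show ?thesis
      using ab(1,3) True by (cases "b = 0") auto
  next
    case False
    then have s: "s = n - 1" using assms(1) by simp
    have "[int u - int m = int u + int a - int b] (mod int n)"
      using ab(2) steps_displacement[of u m] unfolding s by (metis cong_trans cong_sym)
    then have "[(int u + int a - int b) + (int m + int b - int a - int u) =
        (int u - int m) + (int m + int b - int a - int u)] (mod int n)"
      by (intro cong_add cong_refl) (rule cong_sym)
    then have "[int b - int a = int m] (mod int n)"
      by (simp add: cong_def mod_eq_dvd_iff dvd_diff_commute algebra_simps)
    from far[OF this] show ?thesis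
      using ab(1,4) s by (cases "a = 0") auto
  qed
  then show "m \<le> length es" and "length es = m \<Longrightarrow> es = steps n s u m" by auto
qed

lemma awalk_cost_one: "awalk_cost (\<lambda>_. 1) es = real (length es)"
  by (simp add: awalk_cost_def sum_list_triv)

lemma shortest_path_cycle_graph:
  assumes "s \<in> {1, n - 1}" and "2 * m < n" and "u < n"
  defines "v \<equiv> (u + m * s) mod n"
  shows "gdist (cycle_graph n) u v = ereal (real m)"
    and "shortest_path (cycle_graph n) u es v \<longleftrightarrow> es = steps n s u m"
proof -
  have walk: "awalk u (steps n s u m) v"
    using awalk_steps[OF assms(1,3)] by (simp add: v_def)
  then have "reachable (with_proj (cycle_graph n)) u v"
    using reachable_awalk by blast
  then obtain es' where es': "apath u es' v" "gdist (cycle_graph n) u v = awalk_cost (\<lambda>_. 1) es'"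
    unfolding gdist_def using min_cost_awalk[of u v "\<lambda>_. 1"] by auto
  have "gdist (cycle_graph n) u v \<le> awalk_cost (\<lambda>_. 1) (steps n s u m)"
    unfolding gdist_def by (rule min_cost_le_walk_cost[OF walk])
  then have "length es' \<le> m" using es'(2) by (simp add: awalk_cost_one)
  moreover have "m \<le> length es'"
    and unique: "\<And>es. awalk u es v \<Longrightarrow> length es = m \<Longrightarrow> es = steps n s u m"
    using awalk_geodesic[OF assms(1,2)] es'(1) by (auto simp: v_def apath_def)
  ultimately have len: "length es' = m" by simp
  then show dist: "gdist (cycle_graph n) u v = ereal (real m)"
    using es'(2) by (simp add: awalk_cost_one)
  \<comment> \<open>Since es' is a path, this also shows that the vertices of
    \<open>steps n s u m\<close> are distinct.\<close>
  have "es' = steps n s u m"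
    using unique len es'(1) by (auto simp: apath_def)
  then show "shortest_path (cycle_graph n) u es v \<longleftrightarrow> es = steps n s u m"
    using es'(1) len unique[of es] unfolding shortest_path_def dist apath_def by auto
qed

lemma shortest_gain_cycle_graph:
  assumes "s \<in> {1, n - 1}" and "2 * m < n" and "u < n"
  shows "shortest_gain (cycle_graph n) \<phi> u ((u + m * s) mod n) = gain \<phi> (steps n s u m)"
  using shortest_path_cycle_graph(2)[OF assms] by (simp add: shortest_gain_def)

text \<open>A change of direction retraces the edge just used, because the two step sizes add up to
  n. So the first arc fixes the direction of all others.\<close>

lemma awalk_no_backtracking:
  assumes "awalk u es v" and "successively (\<lambda>e e'. snd e' \<noteq> fst e) es"
  shows "\<exists>s \<in> {1, n - 1}. es = steps n s u (length es)"
  using assms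
proof (induction es arbitrary: u)
  case Nil
  then show ?case by auto
next
  case (Cons e es)
  obtain w where e: "e = (u, w)" "(u, w) \<in> parcs (cycle_graph n)" and w: "awalk w es v"
    using Cons.prems(1) by (cases e) (auto simp: awalk_Cons_iff)
  then have "u < n" by (simp add: parcs_cycle_graph_iff)
  have "successively (\<lambda>e e'. snd e' \<noteq> fst e) es"
    using Cons.prems(2) by (auto simp: successively_Cons)
  with Cons.IH[OF w] obtain s where s: "s \<in> {1, n - 1}" "es = steps n s w (length es)"
    by blast
  obtain s' where s': "s' \<in> {1, n - 1}" "w = (u + s') mod n"
    using e(2) unfolding parcs_cycle_graph_iff by blast
  show ?case
  proof (cases es)
    \<comment> \<open>An empty remainder fits both directions, so the direction is taken from the
      first arc.\<close>
    case Nil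
    then show ?thesis using s' e by auto
  next
    case (Cons e' es')
    then have "snd e' = (w + s) mod n" using s(2) by auto
    then have "(w + s) mod n \<noteq> u"
      using Cons \<open>successively _ (e # es)\<close> e by simp
    moreover have "(w + s) mod n = u" if "s \<noteq> s'"
    proof -
      have "s' + s = n" using that s(1) s'(1) n3 by auto
      then have "(u + s' + s) mod n = u" using \<open>u < n\<close> by (simp add: add.assoc)
      then show ?thesis using s'(2) by (simp only: mod_add_left_eq)
    qed
    ultimately have "s = s'" by blast
    then show ?thesis using s s' e by auto
  qed
qed

text \<open>Distinct vertices and length at least 3 forbid backtracking, so the cycle keeps one
  direction. Closing up makes its length a multiple of n, and distinctness bounds it by n.\<close>

lemma oriented_cycle_steps:
  assumes "oriented_cycle (cycle_graph n) C"
  obtains s u where "s \<in> {1, n - 1}" and "u < n" and "C = steps n s u n"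
proof -
  obtain u where C: "awalk u C u" "distinct (tl (pawalk_verts u C))" "3 \<le> length C"
    using assms unfolding oriented_cycle_def cycle_def by auto
  then have "u < n" by auto
  have cas: "pcas u C u" using C(1) by (simp add: awalk_def)
  have verts: "pawalk_verts u C = fst (hd C) # map snd C"
    using awalk_verts_conv'[OF cas] C(3) by auto
  then have dist: "distinct (map snd C)" using C(2) by simp
  have "set (map snd C) \<subseteq> {0..<n}"
    using C(1) verts by (metis awalkE' pverts_cycle_graph set_subset_Cons subset_trans)
  then have "length C \<le> n"
    using dist by (metis card_atLeastLessThan card_mono diff_zero distinct_card finite_atLeastLessThan length_map)
  have tails: "fst (C ! Suc i) = snd (C ! i)" if "Suc i < length C" for i
  proof -
    have "map fst C @ [snd (last C)] = fst (hd C) # map snd C"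
      using awalk_verts_conv[of u C] verts C(3) by (auto split: if_splits)
    then have "(map fst C @ [snd (last C)]) ! Suc i = (fst (hd C) # map snd C) ! Suc i"
      by simp
    then show ?thesis using that by (simp add: nth_append)
  qed
  have "fst (hd C) = u" using cas C(3) by (cases C) auto
  moreover have "last (pawalk_verts u C) = u" using C(1) by blast
  then have "snd (last C) = u" using C(3) by (cases "C = []") (simp_all add: awalk_verts_conv[of u C])
  ultimately have ends: "fst (C ! 0) = snd (C ! (length C - 1))"
    using C(3) by (metis hd_conv_nth last_conv_nth list.size(3) not_numeral_le_zero)
  have inj: "i = j" if "snd (C ! i) = snd (C ! j)" "i < length C" "j < length C" for i j
    using that dist by (auto simp: distinct_conv_nth)
  have "successively (\<lambda>e e'. snd e' \<noteq> fst e) C"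
    unfolding successively_conv_nth
  proof (intro allI impI notI)
    fix i assume i: "Suc i < length C" and eq: "snd (C ! Suc i) = fst (C ! i)"
    show False
    proof (cases i)
      case 0
      \<comment> \<open>The arc before the first one is the last one, so backtracking here would
        give a cycle of length 2. Elsewhere it repeats the head of the arc before
        \<open>C ! i\<close>.\<close>
      have "Suc 0 = length C - 1"
        by (rule inj) (use 0 i eq ends C(3) in auto)
      then show False using C(3) by simp
    next
      case (Suc j)
      then show False using inj[of "Suc i" j] eq tails[of j] i by auto
    qed
  qed
  with awalk_no_backtracking[OF C(1)] obtain s where
    s: "s \<in> {1, n - 1}" "C = steps n s u (length C)" by blast
  have "(u + length C * s) mod n = u"
    using awalk_steps[OF s(1) \<open>u < n\<close>, of "length C"] C(1,3) s(2) awalk_ends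
    by (metis list.size(3) not_numeral_le_zero)
  then have "[u + length C * s = u + 0] (mod n)" using \<open>u < n\<close> by (simp add: cong_def)
  then have "n dvd length C * s" by (simp only: cong_add_lcancel_nat cong_0_iff)
  moreover have "coprime n s"
    using s(1) n3 coprime_diff_one_right_nat[of n] by auto
  ultimately have "n dvd length C" by (simp add: coprime_dvd_mult_left_iff)
  then have "length C = n"
    using \<open>length C \<le> n\<close> C(3) by (auto dest: dvd_imp_le)
  with s \<open>u < n\<close> show ?thesis by (auto intro: that)
qed

end

section \<open>Gains, eigenvectors and the distance matrix\<close>

locale cycle_gain_graph = cycle_digraph n for n :: nat +
  fixes \<phi> :: "nat \<times> nat \<Rightarrow> complex" and k :: real
  assumes csg: "conj_skew_gain_graph (cycle_graph n) \<phi>"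
    and norm_gain: "e \<in> parcs (cycle_graph n) \<Longrightarrow> cmod (\<phi> e) = k"
    and k_pos: "k > 0"
begin

text \<open>This is W of the overview. At v = n it is the gain of the full forward turn, not the
  value 1 belonging to vertex 0.\<close>

definition arc_prod :: "nat \<Rightarrow> complex" where
  "arc_prod v = (\<Prod>i<v. \<phi> (i, (i + 1) mod n))"

lemma forward_arc:
  assumes "u < n"
  shows "(u, (u + 1) mod n) \<in> parcs (cycle_graph n)"
  using assms by (auto simp: parcs_cycle_graph_iff)

lemma norm_arc_prod: "v \<le> n \<Longrightarrow> cmod (arc_prod v) = k ^ v"
  using norm_gain[OF forward_arc] by (simp add: arc_prod_def prod_norm[symmetric])

lemma arc_prod_nonzero: "v \<le> n \<Longrightarrow> arc_prod v \<noteq> 0"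
  using norm_arc_prod[of v] k_pos by auto

lemma forward_eigen:
  assumes "c ^ n = arc_prod n" and "u < n"
  defines "x \<equiv> (\<lambda>v. c ^ v / arc_prod v)"
  shows "\<phi> (u, (u + 1) mod n) * x ((u + 1) mod n) = c * x u"
proof -
  have Suc: "arc_prod (Suc u) = \<phi> (u, (u + 1) mod n) * arc_prod u"
    by (simp add: arc_prod_def)
  have nz: "\<phi> (u, (u + 1) mod n) \<noteq> 0" "arc_prod u \<noteq> 0"
    using arc_prod_nonzero[of "Suc u"] Suc \<open>u < n\<close> by auto
  have "x ((u + 1) mod n) = c ^ Suc u / arc_prod (Suc u)"
  proof (cases "Suc u = n")
    \<comment> \<open>On the closing arc the quotient c^n / W(n) must agree with the entry 1 at
      vertex 0; this is where c has to be an n-th root of the full gain.\<close>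
    case True
    then show ?thesis
      using assms(1) arc_prod_nonzero[of n] by (simp add: x_def arc_prod_def)
  next
    case False
    then show ?thesis using \<open>u < n\<close> by (simp add: x_def)
  qed
  then show ?thesis using nz by (simp add: Suc x_def)
qed

text \<open>The two orientations of an edge have gains with product k^2 = c * \<open>cnj c\<close>.
  Multiplying the forward relation by the backward gain and cancelling c gives the claim.\<close>

lemma backward_eigen:
  assumes "c ^ n = arc_prod n" and "cmod c = k" and "u < n"
  defines "x \<equiv> (\<lambda>v. c ^ v / arc_prod v)"
  shows "\<phi> (u, (u + (n - 1)) mod n) * x ((u + (n - 1)) mod n) = cnj c * x u"
proof -
  define w where "w = (u + (n - 1)) mod n"
  have w: "w < n" "(w + 1) mod n = u"
    using n3 \<open>u < n\<close> by (auto simp: w_def mod_simps)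
  have arc: "(w, u) \<in> parcs (cycle_graph n)" using forward_arc[OF w(1)] w(2) by simp
  have "\<phi> (u, w) = cnj (\<phi> (w, u))"
    using conj_skew_gain_graph.gain_conj[OF csg arc] .
  moreover have "\<phi> (w, u) * cnj (\<phi> (w, u)) = c * cnj c"
    using norm_gain[OF arc] assms(2) by (simp add: complex_norm_square[symmetric])
  moreover have "\<phi> (w, u) * x u = c * x w"
    using forward_eigen[OF assms(1) w(1)] w(2) by (simp add: x_def)
  ultimately have "c * (\<phi> (u, w) * x w) = c * (cnj c * x u)"
    by (metis mult.assoc mult.left_commute)
  moreover have "c \<noteq> 0" using assms(2) k_pos by auto
  ultimately show ?thesis by (simp add: w_def)
qed

text \<open>After a full turn the eigenvector relation returns to the same nonzero entry, so the
  gain is c^n or its conjugate, whatever the starting vertex. The root c is auxiliary.\<close>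

lemma gain_oriented_cycle:
  assumes "oriented_cycle (cycle_graph n) C"
  shows "gain \<phi> C = arc_prod n \<or> gain \<phi> C = cnj (arc_prod n)"
proof -
  obtain s u where su: "s \<in> {1, n - 1}" "u < n" and C: "C = steps n s u n"
    using oriented_cycle_steps[OF assms] .
  define c where "c = rcis k (Arg (arc_prod n) / real n)"
  have c: "c ^ n = arc_prod n"
    using n3 rcis_cmod_Arg[of "arc_prod n"] by (simp add: c_def DeMoivre2 norm_arc_prod)
  have norm_c: "cmod c = k" using k_pos by (simp add: c_def)
  define x where "x v = c ^ v / arc_prod v" for v
  have "x u \<noteq> 0" using norm_c k_pos arc_prod_nonzero[of u] \<open>u < n\<close> by (auto simp: x_def)
  have "gain \<phi> (steps n 1 u n) * x u = c ^ n * x u"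
    using gain_steps[of n \<phi> 1 x c u n] forward_eigen[OF c] \<open>u < n\<close> by (simp add: x_def)
  moreover have "gain \<phi> (steps n (n - 1) u n) * x u = cnj c ^ n * x u"
    using gain_steps[of n \<phi> "n - 1" x "cnj c" u n] backward_eigen[OF c norm_c] \<open>u < n\<close>
    by (simp add: x_def)
  ultimately show ?thesis
    using su C \<open>x u \<noteq> 0\<close> c by (auto simp flip: complex_cnj_power)
qed

lemma distance_matrix_entry:
  assumes "s \<in> {1, n - 1}" and "2 * m < n" and "1 \<le> m" and "u < n"
  shows "distance_matrix (cycle_graph n) \<phi> $$ (u, (u + m * s) mod n) =
    gain \<phi> (steps n s u m) * of_nat m"
proof -
  \<comment> \<open>The entry is off the diagonal because the distances 0 and m differ.\<close>
  have "gdist (cycle_graph n) u u = 0"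
    using shortest_path_cycle_graph(1)[of 1 0 u] \<open>u < n\<close> by (simp add: zero_ereal_def)
  then have "(u + m * s) mod n \<noteq> u"
    using shortest_path_cycle_graph(1)[OF assms(1,2,4)] \<open>1 \<le> m\<close> by auto
  then show ?thesis
    using shortest_path_cycle_graph(1)[OF assms(1,2,4)] shortest_gain_cycle_graph[OF assms(1,2,4)]
      \<open>u < n\<close> by (simp add: distance_matrix_def)
qed

text \<open>In row u, the vertices u + m and u - m contribute m c^m and m \<open>cnj c\<close>^m
  times the entry at u, and the two powers add up to twice a real part.\<close>

lemma distance_matrix_eigenvector:
  assumes "n = 2 * p + 1" and "c ^ n = arc_prod n" and "cmod c = k" and "u < n"
  shows "(\<Sum>v<n. distance_matrix (cycle_graph n) \<phi> $$ (u, v) * (c ^ v / arc_prod v)) =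
    of_real (2 * (\<Sum>m=1..p. real m * Re (c ^ m))) * (c ^ u / arc_prod u)"
proof -
  define A where "A = distance_matrix (cycle_graph n) \<phi>"
  define x where "x v = c ^ v / arc_prod v" for v
  have fwd: "A $$ (u, (u + m) mod n) * x ((u + m) mod n) = of_nat m * c ^ m * x u"
    if "m \<in> {1..p}" for m
  proof -
    have "gain \<phi> (steps n 1 u m) * x ((u + m * 1) mod n) = c ^ m * x u"
      by (rule gain_steps) (use forward_eigen[OF assms(2)] assms(4) in \<open>auto simp: x_def\<close>)
    moreover have "A $$ (u, (u + m * 1) mod n) = gain \<phi> (steps n 1 u m) * of_nat m"
      unfolding A_def by (rule distance_matrix_entry) (use that assms(1,4) in auto)
    ultimately show ?thesis by (simp add: mult_ac)
  qed
  have bwd: "A $$ (u, (u + m * (n - 1)) mod n) * x ((u + m * (n - 1)) mod n) =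
      of_nat m * cnj c ^ m * x u"
    if "m \<in> {1..p}" for m
  proof -
    have "gain \<phi> (steps n (n - 1) u m) * x ((u + m * (n - 1)) mod n) = cnj c ^ m * x u"
      by (rule gain_steps) (use backward_eigen[OF assms(2,3)] assms(4) in \<open>auto simp: x_def\<close>)
    moreover have "A $$ (u, (u + m * (n - 1)) mod n) = gain \<phi> (steps n (n - 1) u m) * of_nat m"
      unfolding A_def by (rule distance_matrix_entry) (use that assms(1,4) in auto)
    ultimately show ?thesis by (simp add: mult_ac)
  qed
  have "A $$ (u, u) = 0" using \<open>u < n\<close> by (simp add: A_def distance_matrix_def)
  then have "(\<Sum>v<n. A $$ (u, v) * x v) =
      (\<Sum>m=1..p. of_nat m * c ^ m * x u + of_nat m * cnj c ^ m * x u)"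
    unfolding sum_cyclic_split[OF \<open>u < n\<close> assms(1)] using fwd bwd
    by (auto intro!: sum.cong simp del: One_nat_def)
  also have "\<dots> = (\<Sum>m=1..p. of_real (2 * (real m * Re (c ^ m))) * x u)"
  proof (rule sum.cong)
    fix m
    have "c ^ m + cnj c ^ m = of_real (2 * Re (c ^ m))"
      using complex_add_cnj[of "c ^ m"] by simp
    then show "of_nat m * c ^ m * x u + of_nat m * cnj c ^ m * x u =
        of_real (2 * (real m * Re (c ^ m))) * x u"
      by (simp add: distrib_right[symmetric] distrib_left[symmetric])
  qed simp
  also have "\<dots> = of_real (2 * (\<Sum>m=1..p. real m * Re (c ^ m))) * x u"
    by (simp only: sum_distrib_right[symmetric] of_real_sum[symmetric] sum_distrib_left[symmetric])
  finally show ?thesis by (simp add: A_def x_def)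
qed

lemma distance_spectrum_cycle_graph:
  assumes n: "n = 2 * p + 1" and inj: "inj_on c {..<n}"
    and c: "\<And>j. j < n \<Longrightarrow> c j ^ n = arc_prod n" and norm_c: "\<And>j. j < n \<Longrightarrow> cmod (c j) = k"
  shows "distance_spectrum (cycle_graph n) \<phi> =
    mset (map (\<lambda>j. of_real (2 * (\<Sum>m=1..p. real m * Re (c j ^ m)))) [0..<n])"
proof -
  define A where "A = distance_matrix (cycle_graph n) \<phi>"
  define l where "l j = complex_of_real (2 * (\<Sum>m=1..p. real m * Re (c j ^ m)))" for j
  define P where "P = mat n n (\<lambda>(v, j). c j ^ v / arc_prod v)"
  \<comment> \<open>The inverse uses reciprocal powers instead of conjugates, since the roots have
    modulus k; the factors W(v) cancel in \<open>Q * P\<close>.\<close>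
  define Q where "Q = mat n n (\<lambda>(i, v). arc_prod v / (of_nat n * c i ^ v))"
  have carrier: "A \<in> carrier_mat n n" "P \<in> carrier_mat n n" "Q \<in> carrier_mat n n"
    by (simp_all add: A_def P_def Q_def distance_matrix_def)
  have c_nz: "c j \<noteq> 0" if "j < n" for j using norm_c[OF that] k_pos by auto
  have "Q * P = 1\<^sub>m n"
  proof (rule eq_matI)
    fix i j assume "i < dim_row (1\<^sub>m n :: complex mat)" "j < dim_col (1\<^sub>m n :: complex mat)"
    then have ij: "i < n" "j < n" by auto
    have "(Q * P) $$ (i, j) = (\<Sum>v<n. (c j / c i) ^ v / of_nat n)"
      using ij arc_prod_nonzero
      by (auto simp: Q_def P_def scalar_prod_def power_divide atLeast0LessThan intro!: sum.cong)
    also have "\<dots> = (\<Sum>v<n. (c j / c i) ^ v) / of_nat n"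
      by (simp only: sum_divide_distrib)
    also have "\<dots> = 1\<^sub>m n $$ (i, j)"
    proof (cases "i = j")
      case True
      then show ?thesis using ij c_nz n3 by simp
    next
      case False
      then have "c j \<noteq> c i" using inj ij by (auto dest: inj_onD)
      then have "(\<Sum>v<n. (c j / c i) ^ v) = 0"
        using c ij c_nz by (intro sum_powers_ratio_roots) auto
      then show ?thesis using False ij by simp
    qed
    finally show "(Q * P) $$ (i, j) = 1\<^sub>m n $$ (i, j)" .
  qed (use carrier in auto)
  moreover have "A * P = P * mat_diag n l"
  proof (rule eq_matI)
    fix u j assume "u < dim_row (P * mat_diag n l)" "j < dim_col (P * mat_diag n l)"
    then have uj: "u < n" "j < n" using carrier by (auto simp: mat_diag_def)
    have "(A * P) $$ (u, j) = (\<Sum>v<n. A $$ (u, v) * (c j ^ v / arc_prod v))"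
      using uj carrier by (auto simp: P_def scalar_prod_def atLeast0LessThan intro!: sum.cong)
    also have "\<dots> = l j * (c j ^ u / arc_prod u)"
      unfolding A_def l_def using distance_matrix_eigenvector[OF n c norm_c] uj by blast
    also have "\<dots> = (P * mat_diag n l) $$ (u, j)"
      using uj by (simp add: mat_diag_mult_right[OF carrier(2)]) (simp add: P_def)
    finally show "(A * P) $$ (u, j) = (P * mat_diag n l) $$ (u, j)" .
  qed (use carrier in \<open>auto simp: mat_diag_def\<close>)
  ultimately have "char_poly A = (\<Prod>j\<leftarrow>[0..<n]. [:- l j, 1:])"
    using char_poly_eigenbasis carrier by blast
  then show ?thesis
    unfolding distance_spectrum_def A_def[symmetric] by (simp only: proots_prod_linear_factors l_def)
qed

end

section \<open>Roots of the cycle gain and the final formula\<close>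

text \<open>Cancelling the common factor of angle \<theta>/n leaves the n distinct n-th roots of
  unity.\<close>

lemma inj_on_rcis_roots:
  assumes "k > 0" and "n > 0"
  shows "inj_on (\<lambda>j. rcis k ((2 * pi * real j + \<theta>) / real n)) {..<n}"
proof (rule inj_onI)
  fix i j assume ij: "i \<in> {..<n}" "j \<in> {..<n}"
    and "rcis k ((2 * pi * real i + \<theta>) / real n) = rcis k ((2 * pi * real j + \<theta>) / real n)"
  then have "cis (2 * pi * real i / real n) * cis (\<theta> / real n) =
      cis (2 * pi * real j / real n) * cis (\<theta> / real n)"
    using assms(1) by (simp add: rcis_def cis_mult add_divide_distrib)
  then have "cis (2 * pi * real i / real n) = cis (2 * pi * real j / real n)"
    by simp
  then show "i = j"
    using Complex.bij_betw_roots_unity[OF assms(2)] ij by (auto simp: bij_betw_def dest: inj_onD)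
qed

theorem theorem5p2:
  fixes p n :: nat and k \<theta> :: real
    and \<phi> :: "nat \<times> nat \<Rightarrow> complex" and C :: "(nat \<times> nat) list"
  assumes "p \<ge> 1" and "n = 2 * p + 1" and "k > 0"
    and "conj_skew_gain_graph (cycle_graph n) \<phi>"
    and "\<forall>e \<in> parcs (cycle_graph n). cmod (\<phi> e) = k"
    and "\<not> balanced (cycle_graph n) \<phi>"
    and "oriented_cycle (cycle_graph n) C"
    and "is_Arg (gain \<phi> C) \<theta>"
  shows "distance_spectrum (cycle_graph n) \<phi> =
    mset (map (\<lambda>j. let \<theta>\<^sub>j = (2 * pi * real j + \<theta>) / real n
                   in complex_of_real (2 * spec_num p k \<theta>\<^sub>j / spec_den k \<theta>\<^sub>j)) [0..<n])"
proof -
  interpret cycle_gain_graph n \<phi> k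
    using assms(1-5)
    by (intro cycle_gain_graph.intro cycle_digraph.intro cycle_gain_graph_axioms.intro) auto
  define t where "t j = (2 * pi * real j + \<theta>) / real n" for j
  have nt: "real n * t j = 2 * pi * real j + \<theta>" for j
    using n3 by (simp add: t_def)
  have cis_nt: "cis (real n * t j) = cis \<theta>" for j
    unfolding nt by (simp add: cis_multiple_2pi flip: cis_mult)
  have gains: "gain \<phi> C' = arc_prod n \<or> gain \<phi> C' = cnj (arc_prod n)"
    if "oriented_cycle (cycle_graph n) C'" for C'
    using gain_oriented_cycle[OF that] .
  then have "cmod (gain \<phi> C) = k ^ n"
    using assms(7) norm_arc_prod[of n] by fastforce
  then have gain_C: "gain \<phi> C = of_real (k ^ n) * cis \<theta>"
    using assms(8) by (simp add: is_Arg_def cis_conv_exp mult.commute)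
  \<comment> \<open>Otherwise the gain of C would be a positive real, equal to its conjugate, and
    hence the gain of every oriented cycle.\<close>
  have "cis \<theta> \<noteq> 1"
  proof
    assume "cis \<theta> = 1"
    then have "gain \<phi> C = of_real (k ^ n)" using gain_C by simp
    then have "arc_prod n = of_real (k ^ n)"
      using gains[OF assms(7)] by (metis complex_cnj_cnj complex_cnj_complex_of_real)
    then have "balanced (cycle_graph n) \<phi>"
      using gains \<open>k > 0\<close> unfolding balanced_def by (fastforce simp: norm_power)
    then show False using assms(6) by simp
  qed
  \<comment> \<open>The angle n * \<open>t j\<close> equals \<theta> up to full turns, so e^(i
    \<open>t j\<close>) = 1 would force e^(i\<theta>) = 1.\<close>
  have cos_t: "cos (t j) \<noteq> 1" for j
  proof
    assume "cos (t j) = 1"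
    then have "cis (t j) = 1"
      using sin_cos_squared_add[of "t j"] by (simp add: complex_eq_iff)
    then have "cis (real n * t j) = 1" using Complex.DeMoivre[of "t j" n] by simp
    then show False using cis_nt \<open>cis \<theta> \<noteq> 1\<close> by simp
  qed
  \<comment> \<open>C may run in either direction, whereas \<open>arc_prod\<close> runs forward.
    Conjugating the roots in the backward case leaves the real parts, and so the eigenvalues,
    unchanged.\<close>
  define c where "c j = (if gain \<phi> C = arc_prod n then rcis k (t j) else cnj (rcis k (t j)))" for j
  have "inj_on (\<lambda>j. rcis k (t j)) {..<n}"
    unfolding t_def using \<open>k > 0\<close> n3 by (intro inj_on_rcis_roots) auto
  then have "inj_on c {..<n}"
    by (simp add: inj_on_def c_def)
  moreover have "c j ^ n = arc_prod n" for j
  proof -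
    have "rcis k (t j) ^ n = gain \<phi> C"
      unfolding DeMoivre2 gain_C by (simp add: rcis_def cis_nt)
    then show ?thesis
      using gains[OF assms(7)] by (auto simp: c_def simp flip: complex_cnj_power)
  qed
  moreover have "cmod (c j) = k" for j
    using \<open>k > 0\<close> by (simp add: c_def)
  ultimately have "distance_spectrum (cycle_graph n) \<phi> =
      mset (map (\<lambda>j. of_real (2 * (\<Sum>m=1..p. real m * Re (c j ^ m)))) [0..<n])"
    by (intro distance_spectrum_cycle_graph assms(2))
  moreover have "(\<Sum>m=1..p. real m * Re (c j ^ m)) = spec_num p k (t j) / spec_den k (t j)" for j
  proof -
    have "Re (c j ^ m) = k ^ m * cos (real m * t j)" for m
      by (simp add: c_def DeMoivre2 flip: complex_cnj_power)
    then have "(\<Sum>m=1..p. real m * Re (c j ^ m)) = (\<Sum>m=1..p. real m * k ^ m * cos (real m * t j))"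
      by (simp add: mult.assoc)
    then show ?thesis
      using spec_den_pos[OF \<open>k > 0\<close> cos_t[of j]] by (simp add: spec_num_eq)
  qed
  ultimately show ?thesis
    by (simp only: Let_def t_def times_divide_eq_right)
qed

end
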